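(* Let $\{(y_i,\mathbf{x}_i)\}_{i=1}^{\infty}$ be an i.i.d. sequence, where $y_i$ takes only the values $0$ and $1$ and $\mathbf{x}_i$ is a $1\times K$ random row vector. Let $R:\mathbb{R}\to[0,1]$ be the ramp function, $R(z)=0$ for $z\le 0$, $R(z)=z$ for $0<z<1$, $R(z)=1$ for $z\ge 1$. Let $\mathcal{B}\subset\mathbb{R}^K$ be compact, and suppose $\boldsymbol{\beta}_o\in\mathcal{B}$ is identified in the sense that for all $\boldsymbol{\beta}\in\mathcal{B}$ with $\boldsymbol{\beta}\neq\boldsymbol{\beta}_o$, $$E\left[\left(y_i-R(\mathbf{x}_i\boldsymbol{\beta}_o)\right)^2\right]<E\left[\left(y_i-R(\mathbf{x}_i\boldsymbol{\beta})\right)^2\right].$$ Let $\hat{\boldsymbol{\beta}}=\hat{\boldsymbol{\beta}}_N$ be the nonlinear least squares estimator, i.e. a minimizer over $\boldsymbol{\beta}\in\mathcal{B}$ of $$Q_N(\boldsymbol{\beta})=\frac1N\sum_{i=1}^N\left(y_i-R(\mathbf{x}_i\boldsymbol{\beta})\right)^2 .$$ Then $\hat{\boldsymbol{\beta}}\overset{p}{\to}\boldsymbol{\beta}_o$ as $N\to\infty$.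
   Context: Vectors $\boldsymbol{\beta}\in\mathbb{R}^K$ are column vectors, so $\mathbf{x}_i\boldsymbol{\beta}$ is a scalar; the first entry of $\mathbf{x}_i$ is the constant $1$ (an intercept). It is not assumed that $E[y_i\mid\mathbf{x}_i]=R(\mathbf{x}_i\boldsymbol{\beta})$ for some $\boldsymbol{\beta}$ (the conditional mean model may be misspecified); $\boldsymbol{\beta}_o$ is the pseudo-true value, the unique minimizer of $E[(y_i-R(\mathbf{x}_i\boldsymbol{\beta}))^2]$ over $\mathcal{B}$. The estimator $\hat{\boldsymbol{\beta}}$ is understood as a (measurable) choice of minimizer of $Q_N$ for each $N$. *)

theory Defs
  imports "HOL-Probability.Probability"
begin

definition ramp :: "real \<Rightarrow> real" where
  "ramp z = (if z \<le> 0 then 0 else if z < 1 then z else 1)"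

text \<open>The pairs are compared through their joint laws. The sample is indexed from 1; the values
  at index 0 play no role.\<close>
definition (in prob_space) iid_sample ::
    "(nat \<Rightarrow> 'a \<Rightarrow> real) \<Rightarrow> (nat \<Rightarrow> 'a \<Rightarrow> real ^ 'k) \<Rightarrow> bool" where
  "iid_sample y x \<longleftrightarrow>
     indep_vars (\<lambda>_. borel) (\<lambda>i \<omega>. (y i \<omega>, x i \<omega>)) {1..} \<and>
     (\<forall>i\<ge>1. distr M borel (\<lambda>\<omega>. (y i \<omega>, x i \<omega>)) = distr M borel (\<lambda>\<omega>. (y 1 \<omega>, x 1 \<omega>)))"

definition nls_objective ::
    "(nat \<Rightarrow> 'a \<Rightarrow> real) \<Rightarrow> (nat \<Rightarrow> 'a \<Rightarrow> real ^ 'k) \<Rightarrow> nat \<Rightarrow> 'a \<Rightarrow> real ^ 'k \<Rightarrow> real" where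
  "nls_objective y x N \<omega> \<beta> = (1 / real N) * (\<Sum>i=1..N. (y i \<omega> - ramp (x i \<omega> \<bullet> \<beta>))\<^sup>2)"

definition (in prob_space) tendsto_in_probability ::
    "(nat \<Rightarrow> 'a \<Rightarrow> 'b::metric_space) \<Rightarrow> 'b \<Rightarrow> bool" where
  "tendsto_in_probability X c \<longleftrightarrow>
     (\<forall>\<epsilon>>0. (\<lambda>N. prob {\<omega> \<in> space M. dist (X N \<omega>) c > \<epsilon>}) \<longlonglongrightarrow> 0)"

end

theory Submission
  imports Defs
begin

text \<open>Wald's argument: the squared residual at \<open>\<beta>'\<close> is at least the one at \<open>\<beta>\<close> minus
  \<open>2 min(1, |x| r)\<close> for all \<open>\<beta>'\<close> within distance \<open>r\<close> of \<open>\<beta>\<close>, and the correction has vanishing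
  mean as \<open>r \<rightarrow> 0\<close>. So near any \<open>\<beta> \<noteq> \<beta>\<^sub>o\<close> the loss excess over \<open>\<beta>\<^sub>o\<close> is bounded below,
  uniformly, by an i.i.d. bounded sequence of positive mean, whose sums are nonpositive with
  exponentially small probability (Hoeffding). Finitely many such neighbourhoods cover
  the points of \<open>B\<close> at distance at least \<open>\<epsilon>\<close> from \<open>\<beta>\<^sub>o\<close>.\<close>

section \<open>Elementary bounds for the ramp and the squared residual\<close>

lemma ramp_eq_clamp: "ramp z = max 0 (min 1 z)"
  by (auto simp: ramp_def)

lemma ramp_measurable [measurable]: "ramp \<in> borel_measurable borel"
  unfolding ramp_eq_clamp[abs_def] by measurable

lemma ramp_bounds: "0 \<le> ramp z" "ramp z \<le> 1"
  by (auto simp: ramp_def)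

lemma ramp_lipschitz: "\<bar>ramp a - ramp b\<bar> \<le> \<bar>a - b\<bar>"
  by (auto simp: ramp_def)

lemma squared_residual_bounds:
  fixes y :: real
  assumes "y \<in> {0, 1}"
  shows "0 \<le> (y - ramp a)\<^sup>2" "(y - ramp a)\<^sup>2 \<le> 1"
  using assms ramp_bounds[of a] by (auto simp: abs_square_le_1)

text \<open>The difference of squares factors. One factor is at most 2 since \<open>y\<close> and
  the ramp values lie in [0,1]; the other is at most \<open>min 1 d\<close> because the ramp is
  1-Lipschitz with range in [0,1]. Truncating at 1 keeps the bound integrable without any moment of
  the regressors.\<close>

lemma squared_residual_diff_le:
  fixes y :: real
  assumes "y \<in> {0, 1}" and "\<bar>a - b\<bar> \<le> d"
  shows "(y - ramp a)\<^sup>2 - (y - ramp b)\<^sup>2 \<le> 2 * min 1 d"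
proof -
  have "\<bar>ramp b - ramp a\<bar> \<le> min 1 d"
    using ramp_lipschitz[of b a] ramp_bounds[of a] ramp_bounds[of b] assms(2) by auto
  moreover have "\<bar>2 * y - ramp a - ramp b\<bar> \<le> 2"
    using assms(1) ramp_bounds[of a] ramp_bounds[of b] by auto
  ultimately have "\<bar>2 * y - ramp a - ramp b\<bar> * \<bar>ramp b - ramp a\<bar> \<le> 2 * min 1 d"
    by (intro mult_mono) auto
  moreover have "(y - ramp a)\<^sup>2 - (y - ramp b)\<^sup>2 = (2 * y - ramp a - ramp b) * (ramp b - ramp a)"
    by (simp add: power2_eq_square algebra_simps)
  ultimately show ?thesis
    by (metis abs_ge_self abs_mult order_trans)
qed

section \<open>Bounded i.i.d. sums and truncated means\<close>

context prob_space
begin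

text \<open>A nonpositive sum means that the sample mean lies below its expectation by at least that
  expectation, which Hoeffding's inequality makes exponentially unlikely.\<close>

lemma iid_sum_nonpos_tendsto_0:
  fixes X :: "nat \<Rightarrow> 'a \<Rightarrow> real"
  assumes indep: "indep_vars (\<lambda>_. borel) X {1..}"
    and distr: "\<And>i. 1 \<le> i \<Longrightarrow> distr M borel (X i) = distr M borel (X 1)"
    and bounded: "AE \<omega> in M. X 1 \<omega> \<in> {a..b}"
    and "a < b" and pos: "0 < expectation (X 1)"
  shows "(\<lambda>N. prob {\<omega> \<in> space M. (\<Sum>i=1..N. X i \<omega>) \<le> 0}) \<longlonglongrightarrow> 0"
proof (rule tendsto_sandwich[where f = "\<lambda>_. 0"])
  define m where "m = expectation (X 1)"
  \<comment> \<open>The exponent per observation in Hoeffding's bound for deviation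
    \<open>m\<close>, so that the bound becomes the geometric sequence
    \<open>exp (- c) ^ N\<close>.\<close>
  define c where "c = 2 * m\<^sup>2 / (b - a)\<^sup>2"
  have "0 < c"
    using pos \<open>a < b\<close> by (simp add: c_def m_def)
  show "\<forall>\<^sub>F N in sequentially. prob {\<omega> \<in> space M. (\<Sum>i=1..N. X i \<omega>) \<le> 0} \<le> exp (- c) ^ N"
    using eventually_ge_at_top[of 1]
  proof eventually_elim
    case (elim N)
    have "indep_vars (\<lambda>_. borel) X {1..N}"
      by (rule indep_vars_subset[OF indep]) auto
    moreover have "random_variable borel (X 1)"
      using indep by (simp add: indep_vars_def2)
    ultimately have "Hoeffding_ineq_iid M {1..N} X (X 1) a b"
      unfolding Hoeffding_ineq_iid_def iid_interval_bounded_random_variables_def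
        iid_interval_bounded_random_variables_axioms_def
      using prob_space_axioms distr bounded atLeastAtMost_iff finite_atLeastAtMost by blast
    \<comment> \<open>Choosing the deviation equal to the mean \<open>m\<close> turns the threshold
      into 0.\<close>
    then have "prob {\<omega> \<in> space M. (\<Sum>i=1..N. X i \<omega>) / real (card {1..N}) \<le> expectation (X 1) - m}
        \<le> exp (- 2 * real (card {1..N}) * m\<^sup>2 / (b - a)\<^sup>2)"
      by (rule Hoeffding_ineq_iid.Hoeffding_ineq_le') (use elim pos \<open>a < b\<close> in \<open>auto simp: m_def\<close>)
    also have "\<dots> = exp (- c) ^ N"
      by (simp add: c_def mult_ac flip: exp_of_nat_mult)
    finally show ?case
      using elim by (simp add: m_def divide_le_0_iff)
  qed
  show "(\<lambda>N. exp (- c) ^ N) \<longlonglongrightarrow> 0"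
    using \<open>0 < c\<close> by (intro LIMSEQ_power_zero) simp
qed simp_all

text \<open>Dominated convergence along the radii 1/(n+1): the integrand tends to 0 pointwise, and
  the truncation supplies the constant dominating function 1.\<close>

lemma expectation_truncated_norm_small:
  fixes x :: "'a \<Rightarrow> 'b::euclidean_space"
  assumes [measurable]: "x \<in> borel_measurable M" and "0 < (e::real)"
  obtains r where "0 < r" "expectation (\<lambda>\<omega>. min 1 (norm (x \<omega>) * r)) < e"
proof -
  have "(\<lambda>n. expectation (\<lambda>\<omega>. min 1 (norm (x \<omega>) * inverse (real (Suc n))))) \<longlonglongrightarrow> expectation (\<lambda>_. 0)"
  proof (rule integral_dominated_convergence[where w = "\<lambda>_. 1"])
    show "AE \<omega> in M. (\<lambda>n. min 1 (norm (x \<omega>) * inverse (real (Suc n)))) \<longlonglongrightarrow> 0"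
    proof (rule AE_I2)
      fix \<omega>
      have "(\<lambda>n. min 1 (norm (x \<omega>) * inverse (real (Suc n)))) \<longlonglongrightarrow> min 1 (norm (x \<omega>) * 0)"
        by (intro tendsto_intros LIMSEQ_inverse_real_of_nat)
      then show "(\<lambda>n. min 1 (norm (x \<omega>) * inverse (real (Suc n)))) \<longlonglongrightarrow> 0"
        by simp
    qed
  qed auto
  then have "\<forall>\<^sub>F n in sequentially.
      expectation (\<lambda>\<omega>. min 1 (norm (x \<omega>) * inverse (real (Suc n)))) < e"
    using \<open>0 < e\<close> by (intro order_tendstoD) auto
  then obtain n where "expectation (\<lambda>\<omega>. min 1 (norm (x \<omega>) * inverse (real (Suc n)))) < e"
    by (auto simp: eventually_sequentially)
  then show thesis
    by (intro that[of "inverse (real (Suc n))"]) auto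
qed

section \<open>From the i.i.d. sample to a locally uniform comparison of losses\<close>

lemma iid_sample_measurable:
  assumes "iid_sample y x" "1 \<le> i"
  shows "y i \<in> borel_measurable M" "x i \<in> borel_measurable M"
proof -
  have *: "(\<lambda>\<omega>. (y i \<omega>, x i \<omega>)) \<in> borel_measurable M"
    using assms by (simp add: iid_sample_def indep_vars_def2)
  show "y i \<in> borel_measurable M"
    using measurable_compose[OF * borel_measurable_continuous_onI[OF continuous_on_fst[OF continuous_on_id]]]
    by simp
  show "x i \<in> borel_measurable M"
    using measurable_compose[OF * borel_measurable_continuous_onI[OF continuous_on_snd[OF continuous_on_id]]]
    by simp
qed

text \<open>Applying one fixed measurable function to every pair preserves independence, and the law
  of the result is the image of the joint law, hence the same for all indices.\<close>

lemma iid_sample_compose: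
  fixes f :: "real \<Rightarrow> real ^ 'k \<Rightarrow> real"
  assumes iid: "iid_sample y x"
    and f: "(\<lambda>p. f (fst p) (snd p)) \<in> borel_measurable (borel \<Otimes>\<^sub>M borel)"
  shows "indep_vars (\<lambda>_. borel) (\<lambda>i \<omega>. f (y i \<omega>) (x i \<omega>)) {1..}"
    and "1 \<le> i \<Longrightarrow> distr M borel (\<lambda>\<omega>. f (y i \<omega>) (x i \<omega>)) = distr M borel (\<lambda>\<omega>. f (y 1 \<omega>) (x 1 \<omega>))"
proof -
  \<comment> \<open>\<open>iid_sample\<close> uses the Borel sets of the product type;
    \<open>borel_prod\<close> identifies them with the product sigma-algebra.\<close>
  have f': "(\<lambda>p. f (fst p) (snd p)) \<in> borel_measurable borel"
    using f by (simp add: borel_prod)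
  have "indep_vars (\<lambda>_. borel) (\<lambda>i \<omega>. (y i \<omega>, x i \<omega>)) {1..}"
    using iid by (simp add: iid_sample_def)
  from indep_vars_compose2[OF this f']
  show "indep_vars (\<lambda>_. borel) (\<lambda>i \<omega>. f (y i \<omega>) (x i \<omega>)) {1..}"
    by simp
  have rv: "(\<lambda>\<omega>. (y j \<omega>, x j \<omega>)) \<in> borel_measurable M" if "1 \<le> j" for j
    using iid that by (simp add: iid_sample_def indep_vars_def2)
  have push: "distr M borel (\<lambda>\<omega>. f (y j \<omega>) (x j \<omega>))
      = distr (distr M borel (\<lambda>\<omega>. (y j \<omega>, x j \<omega>))) borel (\<lambda>p. f (fst p) (snd p))"
    if "1 \<le> j" for j
    by (subst distr_distr[OF f' rv[OF that]]) (simp add: comp_def)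
  show "distr M borel (\<lambda>\<omega>. f (y i \<omega>) (x i \<omega>)) = distr M borel (\<lambda>\<omega>. f (y 1 \<omega>) (x 1 \<omega>))"
    if "1 \<le> i"
  proof -
    have "distr M borel (\<lambda>\<omega>. (y i \<omega>, x i \<omega>)) = distr M borel (\<lambda>\<omega>. (y 1 \<omega>, x 1 \<omega>))"
      using iid that unfolding iid_sample_def by blast
    then show ?thesis
      by (simp only: push[OF that] push[OF order_refl])
  qed
qed

text \<open>The event \<open>A N\<close> depends on the centre \<beta> and the radius only, so one
  measurable event of vanishing probability covers the uncountably many \<beta>' in the
  ball.\<close>

lemma nls_objective_locally_worse:
  fixes x :: "nat \<Rightarrow> 'a \<Rightarrow> real ^ 'k"
  assumes iid: "iid_sample y x"
    and binary: "\<And>i \<omega>. 1 \<le> i \<Longrightarrow> \<omega> \<in> space M \<Longrightarrow> y i \<omega> \<in> {0, 1}"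
    and less: "expectation (\<lambda>\<omega>. (y 1 \<omega> - ramp (x 1 \<omega> \<bullet> \<beta>\<^sub>o))\<^sup>2)
      < expectation (\<lambda>\<omega>. (y 1 \<omega> - ramp (x 1 \<omega> \<bullet> \<beta>))\<^sup>2)"
  obtains r A where "0 < r" "range A \<subseteq> events" "(\<lambda>N. prob (A N)) \<longlonglongrightarrow> 0"
    "\<And>N \<omega> \<beta>'. 1 \<le> N \<Longrightarrow> \<omega> \<in> space M \<Longrightarrow> \<beta>' \<in> ball \<beta> r \<Longrightarrow>
      nls_objective y x N \<omega> \<beta>' \<le> nls_objective y x N \<omega> \<beta>\<^sub>o \<Longrightarrow> \<omega> \<in> A N"
proof -
  note [measurable] = iid_sample_measurable[OF iid]
  define g where "g \<gamma> v u = (v - ramp (u \<bullet> \<gamma>))\<^sup>2" for v :: real and u \<gamma> :: "real ^ 'k"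
  have [measurable]: "(\<lambda>\<omega>. g \<gamma> (y i \<omega>) (x i \<omega>)) \<in> borel_measurable M" if "1 \<le> i" for i \<gamma>
    using iid_sample_measurable[OF iid that] unfolding g_def by measurable
  have g01: "0 \<le> g \<gamma> (y i \<omega>) (x i \<omega>)" "g \<gamma> (y i \<omega>) (x i \<omega>) \<le> 1"
    if "1 \<le> i" "\<omega> \<in> space M" for i \<omega> \<gamma>
    using squared_residual_bounds[OF binary[OF that]] by (simp_all add: g_def)
  have int_g: "integrable M (\<lambda>\<omega>. g \<gamma> (y 1 \<omega>) (x 1 \<omega>))" for \<gamma>
    by (rule integrable_const_bound[where B = 1]) (auto simp: g01)
  define \<Delta> where "\<Delta> = expectation (\<lambda>\<omega>. g \<beta> (y 1 \<omega>) (x 1 \<omega>))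
      - expectation (\<lambda>\<omega>. g \<beta>\<^sub>o (y 1 \<omega>) (x 1 \<omega>))"
  have "0 < \<Delta>"
    using less by (simp add: \<Delta>_def g_def)
  \<comment> \<open>Half of the population excess loss \<Delta>, because the correction enters
    \<open>f\<close> with the factor 2; the mean of \<open>f\<close> then stays positive.\<close>
  then obtain r where r: "0 < r" "expectation (\<lambda>\<omega>. min 1 (norm (x 1 \<omega>) * r)) < \<Delta> / 2"
    using expectation_truncated_norm_small[of "x 1" "\<Delta> / 2"] by auto
  have int_m: "integrable M (\<lambda>\<omega>. min 1 (norm (x 1 \<omega>) * r))"
    by (rule integrable_const_bound[where B = 1]) (use r in auto)
  \<comment> \<open>A lower bound, free of \<beta>', for the loss at any \<beta>' in the ball minus
    the loss at \<open>\<beta>\<^sub>o\<close>.\<close>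
  define f where "f v u = g \<beta> v u - 2 * min 1 (norm u * r) - g \<beta>\<^sub>o v u" for v u
  define A where "A N = {\<omega> \<in> space M. (\<Sum>i=1..N. f (y i \<omega>) (x i \<omega>)) \<le> 0}" for N
  have f: "(\<lambda>p. f (fst p) (snd p)) \<in> borel_measurable (borel \<Otimes>\<^sub>M borel)"
    unfolding f_def g_def by measurable
  have fm: "(\<lambda>\<omega>. f (y i \<omega>) (x i \<omega>)) \<in> borel_measurable M" if "1 \<le> i" for i
    using iid_sample_measurable[OF iid that] unfolding f_def g_def by measurable
  have "(\<lambda>\<omega>. \<Sum>i=1..N. f (y i \<omega>) (x i \<omega>)) \<in> borel_measurable M" for N
    by (intro borel_measurable_sum fm) auto
  then have "A N \<in> events" for N
    unfolding A_def by measurable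
  then have A_events: "range A \<subseteq> events"
    by blast
  have A_tendsto: "(\<lambda>N. prob (A N)) \<longlonglongrightarrow> 0"
    unfolding A_def
  \<comment> \<open>Both losses lie in [0,1] and the correction in [0,2], whence the interval from
    -3 to 1.\<close>
  proof (rule iid_sum_nonpos_tendsto_0[where a = "-3" and b = 1])
    show "AE \<omega> in M. f (y 1 \<omega>) (x 1 \<omega>) \<in> {-3..1}"
    proof (rule AE_I2)
      fix \<omega> assume "\<omega> \<in> space M"
      moreover have "0 \<le> min 1 (norm (x 1 \<omega>) * r)" "min 1 (norm (x 1 \<omega>) * r) \<le> 1"
        using r(1) by auto
      ultimately show "f (y 1 \<omega>) (x 1 \<omega>) \<in> {-3..1}"
        using g01[of 1 \<omega> \<beta>] g01[of 1 \<omega> \<beta>\<^sub>o] unfolding f_def atLeastAtMost_iff by linarith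
    qed
    show "0 < expectation (\<lambda>\<omega>. f (y 1 \<omega>) (x 1 \<omega>))"
      using int_g int_m r by (simp add: f_def \<Delta>_def)
    show "indep_vars (\<lambda>_. borel) (\<lambda>i \<omega>. f (y i \<omega>) (x i \<omega>)) {1..}"
      by (rule iid_sample_compose(1)[OF iid f])
    show "distr M borel (\<lambda>\<omega>. f (y i \<omega>) (x i \<omega>)) = distr M borel (\<lambda>\<omega>. f (y 1 \<omega>) (x 1 \<omega>))"
      if "1 \<le> i" for i
      by (rule iid_sample_compose(2)[OF iid f that])
  qed simp
  have "\<omega> \<in> A N"
    if N: "1 \<le> N" and \<omega>: "\<omega> \<in> space M" and \<beta>': "\<beta>' \<in> ball \<beta> r"
      and le: "nls_objective y x N \<omega> \<beta>' \<le> nls_objective y x N \<omega> \<beta>\<^sub>o" for N \<omega> \<beta>'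
  proof -
    have "f (y i \<omega>) (x i \<omega>) \<le> g \<beta>' (y i \<omega>) (x i \<omega>) - g \<beta>\<^sub>o (y i \<omega>) (x i \<omega>)" if "i \<in> {1..N}" for i
    proof -
      \<comment> \<open>Cauchy-Schwarz controls the change of the linear index over the whole ball
        at once.\<close>
      have "\<bar>x i \<omega> \<bullet> \<beta> - x i \<omega> \<bullet> \<beta>'\<bar> \<le> norm (x i \<omega>) * norm (\<beta> - \<beta>')"
        by (metis Cauchy_Schwarz_ineq2 inner_diff_right)
      also have "\<dots> \<le> norm (x i \<omega>) * r"
        using \<beta>' by (intro mult_left_mono) (auto simp: dist_norm)
      finally have "(y i \<omega> - ramp (x i \<omega> \<bullet> \<beta>))\<^sup>2 - (y i \<omega> - ramp (x i \<omega> \<bullet> \<beta>'))\<^sup>2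
          \<le> 2 * min 1 (norm (x i \<omega>) * r)"
        using that \<omega> by (intro squared_residual_diff_le binary) auto
      then show ?thesis
        by (simp add: f_def g_def)
    qed
    then have "(\<Sum>i=1..N. f (y i \<omega>) (x i \<omega>))
        \<le> (\<Sum>i=1..N. g \<beta>' (y i \<omega>) (x i \<omega>) - g \<beta>\<^sub>o (y i \<omega>) (x i \<omega>))"
      by (rule sum_mono)
    also have "\<dots> \<le> 0"
      using le N by (simp add: nls_objective_def g_def sum_subtractf divide_le_cancel)
    finally show ?thesis
      using \<omega> by (simp add: A_def)
  qed
  with r(1) A_events A_tendsto show thesis
    by (rule that)
qed

end

section \<open>Covering by finitely many balls, and consistency\<close>

theorem theorem1:
  fixes M :: "'a measure"
    and y :: "nat \<Rightarrow> 'a \<Rightarrow> real"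
    and x :: "nat \<Rightarrow> 'a \<Rightarrow> real ^ 'k"
    and k0 :: 'k
    and B :: "(real ^ 'k) set"
    and \<beta>\<^sub>o :: "real ^ 'k"
    and \<beta>hat :: "nat \<Rightarrow> 'a \<Rightarrow> real ^ 'k"
  assumes "prob_space M"
    and iid: "prob_space.iid_sample M y x"
    and binary: "\<And>i \<omega>. 1 \<le> i \<Longrightarrow> \<omega> \<in> space M \<Longrightarrow> y i \<omega> \<in> {0, 1}"
    and intercept: "\<And>i \<omega>. 1 \<le> i \<Longrightarrow> \<omega> \<in> space M \<Longrightarrow> x i \<omega> $ k0 = 1"
    and "compact B"
    and "\<beta>\<^sub>o \<in> B"
    and identified: "\<And>i \<beta>. 1 \<le> i \<Longrightarrow> \<beta> \<in> B \<Longrightarrow> \<beta> \<noteq> \<beta>\<^sub>o \<Longrightarrow>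
      prob_space.expectation M (\<lambda>\<omega>. (y i \<omega> - ramp (x i \<omega> \<bullet> \<beta>\<^sub>o))\<^sup>2)
        < prob_space.expectation M (\<lambda>\<omega>. (y i \<omega> - ramp (x i \<omega> \<bullet> \<beta>))\<^sup>2)"
    and measurable: "\<And>N. 1 \<le> N \<Longrightarrow> \<beta>hat N \<in> borel_measurable M"
    and minimizer: "\<And>N \<omega>. 1 \<le> N \<Longrightarrow> \<omega> \<in> space M \<Longrightarrow>
      is_arg_min (nls_objective y x N \<omega>) (\<lambda>\<beta>. \<beta> \<in> B) (\<beta>hat N \<omega>)"
  shows "prob_space.tendsto_in_probability M \<beta>hat \<beta>\<^sub>o"
proof -
  interpret prob_space M by fact
  show ?thesis
    unfolding tendsto_in_probability_def
  proof (intro allI impI)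
    fix \<epsilon> :: real assume "0 < \<epsilon>"
    \<comment> \<open>Removing an open ball keeps \<open>K\<close> compact; an estimate farther than
      \<epsilon> from \<open>\<beta>\<^sub>o\<close> lies in \<open>K\<close>.\<close>
    define K where "K = B - ball \<beta>\<^sub>o \<epsilon>"
    have "compact K"
      unfolding K_def by (intro compact_diff \<open>compact B\<close>) simp
    \<comment> \<open>Packages the local comparison as a predicate, so that a radius and a sequence
      of events can be chosen as functions of the centre.\<close>
    define P where "P \<beta> r A \<longleftrightarrow> 0 < r \<and> range A \<subseteq> events \<and> (\<lambda>N. prob (A N)) \<longlonglongrightarrow> 0 \<and>
      (\<forall>N\<ge>1. \<forall>\<omega>\<in>space M. \<forall>\<beta>'\<in>ball \<beta> r.
        nls_objective y x N \<omega> \<beta>' \<le> nls_objective y x N \<omega> \<beta>\<^sub>o \<longrightarrow> \<omega> \<in> A N)"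
      for \<beta> r A
    have "\<exists>r A. P \<beta> r A" if "\<beta> \<in> K" for \<beta>
    proof -
      have "\<beta> \<in> B" "\<beta> \<noteq> \<beta>\<^sub>o"
        using that \<open>0 < \<epsilon>\<close> by (auto simp: K_def)
      show ?thesis
      proof (rule nls_objective_locally_worse[OF iid _ identified[OF order_refl \<open>\<beta> \<in> B\<close> \<open>\<beta> \<noteq> \<beta>\<^sub>o\<close>]])
        show "y i \<omega> \<in> {0, 1}" if "1 \<le> i" "\<omega> \<in> space M" for i \<omega>
          using that by (rule binary)
      next
        fix r A
        assume "0 < r" "range A \<subseteq> events" "(\<lambda>N. prob (A N)) \<longlonglongrightarrow> 0"
          and "\<And>N \<omega> \<beta>'. 1 \<le> N \<Longrightarrow> \<omega> \<in> space M \<Longrightarrow> \<beta>' \<in> ball \<beta> r \<Longrightarrow>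
            nls_objective y x N \<omega> \<beta>' \<le> nls_objective y x N \<omega> \<beta>\<^sub>o \<Longrightarrow> \<omega> \<in> A N"
        then have "P \<beta> r A"
          unfolding P_def by blast
        then show ?thesis
          by blast
      qed
    qed
    then obtain r A where P: "\<And>\<beta>. \<beta> \<in> K \<Longrightarrow> P \<beta> (r \<beta>) (A \<beta>)"
      by metis
    have r: "0 < r \<beta>" and A: "range (A \<beta>) \<subseteq> events" "(\<lambda>N. prob (A \<beta> N)) \<longlonglongrightarrow> 0"
        "\<And>N \<omega> \<beta>'. 1 \<le> N \<Longrightarrow> \<omega> \<in> space M \<Longrightarrow> \<beta>' \<in> ball \<beta> (r \<beta>) \<Longrightarrow>
          nls_objective y x N \<omega> \<beta>' \<le> nls_objective y x N \<omega> \<beta>\<^sub>o \<Longrightarrow> \<omega> \<in> A \<beta> N"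
      if "\<beta> \<in> K" for \<beta>
      using P[OF that] unfolding P_def by blast+
    \<comment> \<open>The radii come from population means, so the finite cover is the same for
      every \<open>N\<close> and \<omega> and the union bound has a fixed number of terms.\<close>
    obtain F where F: "F \<subseteq> K" "finite F" "K \<subseteq> (\<Union>\<beta>\<in>F. ball \<beta> (r \<beta>))"
    proof (rule compactE_image[OF \<open>compact K\<close>, of K "\<lambda>\<beta>. ball \<beta> (r \<beta>)"])
      show "K \<subseteq> (\<Union>\<beta>\<in>K. ball \<beta> (r \<beta>))"
        using r by force
    qed auto
    show "(\<lambda>N. prob {\<omega> \<in> space M. dist (\<beta>hat N \<omega>) \<beta>\<^sub>o > \<epsilon>}) \<longlonglongrightarrow> 0"
    proof (rule tendsto_sandwich[where f = "\<lambda>_. 0"])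
      show "\<forall>\<^sub>F N in sequentially. prob {\<omega> \<in> space M. dist (\<beta>hat N \<omega>) \<beta>\<^sub>o > \<epsilon>}
          \<le> (\<Sum>\<beta>\<in>F. prob (A \<beta> N))"
        using eventually_ge_at_top[of 1]
      proof eventually_elim
        case (elim N)
        have events: "A \<beta> N \<in> events" if "\<beta> \<in> F" for \<beta>
          using A(1) F(1) that by blast
        \<comment> \<open>A far estimate falls into some ball of the cover. As a minimizer it does
          no worse than the competitor \<open>\<beta>\<^sub>o\<close>, which forces the event
          attached to that ball.\<close>
        have "{\<omega> \<in> space M. dist (\<beta>hat N \<omega>) \<beta>\<^sub>o > \<epsilon>} \<subseteq> (\<Union>\<beta>\<in>F. A \<beta> N)"
        proof
          fix \<omega> assume \<omega>: "\<omega> \<in> {\<omega> \<in> space M. dist (\<beta>hat N \<omega>) \<beta>\<^sub>o > \<epsilon>}"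
          then have min: "is_arg_min (nls_objective y x N \<omega>) (\<lambda>\<beta>. \<beta> \<in> B) (\<beta>hat N \<omega>)"
            using minimizer elim by blast
          then have "\<beta>hat N \<omega> \<in> K"
            using \<omega> by (auto simp: K_def is_arg_min_def dist_commute)
          then obtain \<beta> where \<beta>: "\<beta> \<in> F" "\<beta>hat N \<omega> \<in> ball \<beta> (r \<beta>)"
            using F(3) by blast
          have "nls_objective y x N \<omega> (\<beta>hat N \<omega>) \<le> nls_objective y x N \<omega> \<beta>\<^sub>o"
            using min \<open>\<beta>\<^sub>o \<in> B\<close> by (auto simp: is_arg_min_linorder)
          then have "\<omega> \<in> A \<beta> N"
            using A(3) \<beta> F(1) \<omega> elim by blast
          then show "\<omega> \<in> (\<Union>\<beta>\<in>F. A \<beta> N)"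
            using \<beta>(1) by blast
        qed
        then have "prob {\<omega> \<in> space M. dist (\<beta>hat N \<omega>) \<beta>\<^sub>o > \<epsilon>} \<le> prob (\<Union>\<beta>\<in>F. A \<beta> N)"
          using events F(2) by (intro finite_measure_mono) auto
        also have "\<dots> \<le> (\<Sum>\<beta>\<in>F. prob (A \<beta> N))"
          using events F(2) by (intro finite_measure_subadditive_finite) auto
        finally show ?case .
      qed
      show "(\<lambda>N. \<Sum>\<beta>\<in>F. prob (A \<beta> N)) \<longlonglongrightarrow> 0"
        using A(2) F(1) by (intro tendsto_null_sum) auto
    qed simp_all
  qed
qed

end
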